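(* For all integers $n\ge 1$ and $d\ge 1$ there is a constant $C(n,d)>0$, depending only on $n$ and $d$, such that the following holds. Let $Z\subset B^n$ be a finite set with at least two points, and let $\rho>0$ be the minimal (Euclidean) distance between distinct points of $Z$. Then $$\frac{(d+1)!}{2}\,\hat{\mathcal R}_d(Z)\ \le\ \mathcal{RG}_d(Z)\ \le\ \frac{C(n,d)}{\rho^{d+1}}\,\hat{\mathcal R}_d(Z).$$
   Context: $B^n\subset\mathbb R^n$ is the closed Euclidean unit ball. For a $C^{d+1}$ function $f:B^n\to\mathbb R$ (all partial derivatives of order at most $d+1$ exist and are continuous on $B^n$) and $0\le l\le d+1$, put $M_l(f)=\max_{z\in B^n}\|f^{(l)}(z)\|$, where $\|f^{(l)}(z)\|$ is the sum of the absolute values of all partial derivatives of $f$ of order $l$ at $z$, i.e. $\|f^{(l)}(z)\|=\sum_{(i_1,\dots,i_l)\in\{1,\dots,n\}^l}\left|\frac{\partial^l f}{\partial x_{i_1}\cdots\partial x_{i_l}}(z)\right|$; in particular $M_0(f)=\max_{B^n}|f|$. Rigidity constant: for $Z\subset B^n$, $U_d(Z)$ is the set of $C^{d+1}$ functions $f$ on $B^n$ vanishing on $Z$ (and possibly elsewhere) with $M_0(f)=1$, and $\mathcal{RG}_d(Z)=\inf_{f\in U_d(Z)}M_{d+1}(f)$. Remez constant: $\mathcal R_d(Z)\in[1,\infty]$ is the minimal $K$ such that $\sup_{B^n}|P|\le K\sup_Z|P|$ for every real polynomial $P(x_1,\dots,x_n)$ of degree at most $d$, with $\mathcal R_d(Z)=\infty$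 if no finite such $K$ exists. The inverse Remez constant is $\hat{\mathcal R}_d(Z)=1/\mathcal R_d(Z)$, with $1/\infty=0$. *)

theory Defs
  imports "HOL-Analysis.Analysis"
begin

text \<open>The ball B^n is \<open>cball 0 1\<close> in \<open>real ^ 'n\<close>, with n = CARD('n). A function on B^n is modelled by a
  total function; every notion below depends only on its values on \<open>cball 0 1\<close>.\<close>

text \<open>Partial derivatives on the closed ball: at interior points the usual derivative along the
  coordinate axis, at boundary points (where the axis direction may leave the ball on both sides)
  its continuous extension from the interior.\<close>

definition partial_deriv :: "'n::finite \<Rightarrow> (real ^ 'n \<Rightarrow> real) \<Rightarrow> real ^ 'n \<Rightarrow> real" where
  "partial_deriv i f x =
     (let g = (\<lambda>y. deriv (\<lambda>t. f (y + t *\<^sub>R axis i 1)) 0)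
      in if x \<in> ball 0 1 then g x else Lim (at x within ball 0 1) g)"

text \<open>\<open>partials [i1, \<dots>, il] f\<close> is the partial derivative of order l of f with respect to
  the coordinates i1, ..., il, the last one being taken first.\<close>

definition partials :: "'n::finite list \<Rightarrow> (real ^ 'n \<Rightarrow> real) \<Rightarrow> real ^ 'n \<Rightarrow> real" where
  "partials is f = foldr partial_deriv is f"

text \<open>Continuity on the closed ball includes the existence of the boundary limits used in
  \<open>partial_deriv\<close>.\<close>

definition C_ball :: "nat \<Rightarrow> (real ^ 'n::finite \<Rightarrow> real) \<Rightarrow> bool" where
  "C_ball k f \<longleftrightarrow>
     (\<forall>is i. length is < k \<longrightarrow> (\<forall>x\<in>ball 0 1.
        (\<lambda>t. partials is f (x + t *\<^sub>R axis i 1)) differentiable (at (0::real)))) \<and>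
     (\<forall>is. length is \<le> k \<longrightarrow> continuous_on (cball 0 1) (partials is f))"

definition deriv_norm :: "nat \<Rightarrow> (real ^ 'n::finite \<Rightarrow> real) \<Rightarrow> real ^ 'n \<Rightarrow> real" where
  "deriv_norm l f z = (\<Sum>is | length is = l. \<bar>partials is f z\<bar>)"

text \<open>For f of class C^k and l at most k the supremum is over a continuous function on a
  compact set, hence a maximum.\<close>

definition M :: "nat \<Rightarrow> (real ^ 'n::finite \<Rightarrow> real) \<Rightarrow> real" where
  "M l f = (SUP z\<in>cball 0 1. deriv_norm l f z)"

definition U :: "nat \<Rightarrow> (real ^ 'n::finite) set \<Rightarrow> (real ^ 'n \<Rightarrow> real) set" where
  "U d Z = {f. C_ball (d + 1) f \<and> (\<forall>z\<in>Z. f z = 0) \<and> M 0 f = 1}"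

definition RG :: "nat \<Rightarrow> (real ^ 'n::finite) set \<Rightarrow> real" where
  "RG d Z = (INF f\<in>U d Z. M (d + 1) f)"

text \<open>Real polynomials in n variables of degree at most d, as functions; the sum is over the
  multi-indices of total degree at most d.\<close>

definition poly_fun_le :: "nat \<Rightarrow> (real ^ 'n::finite \<Rightarrow> real) set" where
  "poly_fun_le d =
     {P. \<exists>c :: ('n \<Rightarrow> nat) \<Rightarrow> real.
        P = (\<lambda>x. \<Sum>\<alpha> | (\<Sum>i\<in>UNIV. \<alpha> i) \<le> d. c \<alpha> * (\<Prod>i\<in>UNIV. (x $ i) ^ \<alpha> i))}"

lemma finite_multi_indices: "finite {\<alpha> :: 'n::finite \<Rightarrow> nat. (\<Sum>i\<in>UNIV. \<alpha> i) \<le> d}"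
proof (rule finite_subset)
  show "{\<alpha> :: 'n \<Rightarrow> nat. (\<Sum>i\<in>UNIV. \<alpha> i) \<le> d} \<subseteq> UNIV \<rightarrow>\<^sub>E {..d}"
  proof
    fix \<alpha> :: "'n \<Rightarrow> nat" assume "\<alpha> \<in> {\<alpha>. (\<Sum>i\<in>UNIV. \<alpha> i) \<le> d}"
    moreover have "\<alpha> j \<le> (\<Sum>i\<in>UNIV. \<alpha> i)" for j
      by (rule member_le_sum) simp_all
    ultimately have "\<alpha> j \<le> d" for j
      by (metis le_trans mem_Collect_eq)
    then show "\<alpha> \<in> UNIV \<rightarrow>\<^sub>E {..d}"
      by (simp add: PiE_def Pi_def extensional_def)
  qed
  show "finite ((UNIV :: 'n set) \<rightarrow>\<^sub>E {..d})"
    by (intro finite_PiE) simp_all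
qed

text \<open>The infimum of the empty set in \<open>ereal\<close> is \<open>\<infinity>\<close>. The real suprema are meant for
  nonempty Z contained in the ball.\<close>

definition Remez :: "nat \<Rightarrow> (real ^ 'n::finite) set \<Rightarrow> ereal" where
  "Remez d Z = Inf {ereal K | K. \<forall>P\<in>poly_fun_le d.
     (SUP x\<in>cball 0 1. \<bar>P x\<bar>) \<le> K * (SUP z\<in>Z. \<bar>P z\<bar>)}"

text \<open>Division in \<open>ereal\<close> satisfies 1 / \<open>\<infinity>\<close> = 0.\<close>

definition inv_Remez :: "nat \<Rightarrow> (real ^ 'n::finite) set \<Rightarrow> real" where
  "inv_Remez d Z = real_of_ereal (1 / Remez d Z)"

definition min_dist :: "(real ^ 'n::finite) set \<Rightarrow> real" where
  "min_dist Z = Min {dist x y | x y. x \<in> Z \<and> y \<in> Z \<and> x \<noteq> y}"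

end

theory Submission imports Defs begin

text \<open>Lower bound: the Taylor polynomial \<open>P\<close> of degree d at 0 of a competitor \<open>f\<close> is within
  \<open>\<epsilon> = M (d + 1) f / (d + 1)!\<close> of \<open>f\<close> on the ball, so \<open>\<bar>P\<bar> \<le> \<epsilon>\<close> on Z while its supremum is at least
  \<open>1 - \<epsilon>\<close>; every admissible Remez constant \<open>K \<ge> 1\<close> then satisfies \<open>1 - \<epsilon> \<le> K \<epsilon>\<close>, hence \<open>2 K \<epsilon> \<ge> 1\<close>.

  Upper bound: for a polynomial \<open>P\<close> that is small on Z, subtract \<open>P z\<close> times a bump of width comparable to
  \<open>\<rho>\<close> around each z in Z. The bumps have disjoint supports and the derivatives of \<open>P\<close> of order d + 1
  vanish, so the result vanishes on Z and its derivatives of order d + 1 are at most of size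
  \<open>C \<rho>^-(d+1) sup_Z \<bar>P\<bar>\<close>. If \<open>K \<ge> 2\<close> is not a Remez constant, a \<open>P\<close> witnessing this keeps at least half of its
  supremum; for \<open>K < 2\<close> one uses \<open>P = 1\<close>, which is unchanged at the midpoint of a closest pair.\<close>

section \<open>Partial derivatives on the ball\<close>

text \<open>\<open>F is\<close> stands for the partial derivative of \<open>F []\<close> in the directions \<open>is\<close>. Unlike \<^const>\<open>partials\<close>,
  such a family is compatible with sums and products without appeal to \<^const>\<open>Lim\<close> at the boundary.\<close>

definition jet :: "nat \<Rightarrow> ('n::finite list \<Rightarrow> real ^ 'n \<Rightarrow> real) \<Rightarrow> bool" where
  "jet k F \<longleftrightarrow>
     (\<forall>is i. length is < k \<longrightarrow> (\<forall>x\<in>ball 0 1.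
        ((\<lambda>t. F is (x + t *\<^sub>R axis i 1)) has_real_derivative F (i # is) x) (at 0))) \<and>
     (\<forall>is. length is \<le> k \<longrightarrow> continuous_on (cball 0 1) (F is))"

lemma jetD_deriv:
  "jet k F \<Longrightarrow> length is < k \<Longrightarrow> x \<in> ball 0 1 \<Longrightarrow>
    ((\<lambda>t. F is (x + t *\<^sub>R axis i 1)) has_real_derivative F (i # is) x) (at 0)"
  unfolding jet_def by blast

lemma jetD_cont: "jet k F \<Longrightarrow> length is \<le> k \<Longrightarrow> continuous_on (cball 0 1) (F is)"
  unfolding jet_def by blast

lemma eventually_line_in_ball:
  fixes x v :: "real ^ 'n::finite"
  assumes "x \<in> ball 0 1"
  shows "\<forall>\<^sub>F t in nhds 0. x + t *\<^sub>R v \<in> ball 0 1"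
proof -
  have "isCont (\<lambda>t. x + t *\<^sub>R v) 0"
    by (intro continuous_intros)
  then have "((\<lambda>t. x + t *\<^sub>R v) \<longlongrightarrow> x) (nhds 0)"
    unfolding continuous_within using tendsto_at_iff_tendsto_nhds[of "\<lambda>t. x + t *\<^sub>R v" 0] by simp
  then show ?thesis
    by (rule topological_tendstoD) (use assms in auto)
qed

text \<open>Induction on the list. Inside the ball a derivative at 0 only sees nearby points of the
  line, which stay in the ball. On the sphere, the continuity of \<open>F (i # is)\<close> on the
  closed ball identifies the \<open>Lim\<close> of the interior derivatives.\<close>

lemma partials_jet:
  assumes F: "jet k F" and "length is \<le> k" and "x \<in> cball 0 1"
  shows "partials is (F []) x = F is x"
  using assms(2,3)
proof (induction "is" arbitrary: x)
  case Nil
  then show ?case by (simp add: partials_def)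
next
  case (Cons i "is")
  define g where "g = (\<lambda>y. deriv (\<lambda>t. partials is (F []) (y + t *\<^sub>R axis i 1)) 0)"
  have g: "g y = F (i # is) y" if y: "y \<in> ball 0 1" for y
  proof -
    have "\<forall>\<^sub>F t in nhds 0. partials is (F []) (y + t *\<^sub>R axis i 1) = F is (y + t *\<^sub>R axis i 1)"
      using eventually_line_in_ball[OF y, of "axis i 1"]
      by eventually_elim (use Cons in auto)
    then have "g y = deriv (\<lambda>t. F is (y + t *\<^sub>R axis i 1)) 0"
      unfolding g_def by (intro deriv_cong_ev) auto
    also have "\<dots> = F (i # is) y"
      using jetD_deriv[OF F _ y] Cons.prems by (intro DERIV_imp_deriv) auto
    finally show ?thesis .
  qed
  have "partials (i # is) (F []) x = (if x \<in> ball 0 1 then g x else Lim (at x within ball 0 1) g)"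
    by (simp add: partials_def partial_deriv_def g_def Let_def)
  also have "\<dots> = F (i # is) x"
  proof (cases "x \<in> ball 0 1")
    case True
    then show ?thesis using g by simp
  next
    case False
    have "(F (i # is) \<longlongrightarrow> F (i # is) x) (at x within cball 0 1)"
      using jetD_cont[OF F Cons.prems(1)] Cons.prems(2) by (simp add: continuous_on_def)
    then have "(F (i # is) \<longlongrightarrow> F (i # is) x) (at x within ball 0 1)"
      by (rule tendsto_within_subset) auto
    moreover have "\<forall>\<^sub>F y in at x within ball 0 1. F (i # is) y = g y"
      using g by (auto simp: eventually_at_filter)
    ultimately have "(g \<longlongrightarrow> F (i # is) x) (at x within ball 0 1)"
      by (rule Lim_transform_eventually)
    \<comment> \<open>Uniqueness of the limit, and so the value of \<open>Lim\<close>, needs every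
      point of the closed ball to be a limit point of the open one.\<close>
    moreover have "\<not> trivial_limit (at x within ball 0 1)"
      unfolding trivial_limit_within using Cons.prems(2) by (simp add: islimpt_ball)
    ultimately show ?thesis using False by (simp add: tendsto_Lim)
  qed
  finally show ?case .
qed

text \<open>Used to recognise constructed functions as members of \<open>U\<close>, without
  computing any \<open>Lim\<close>.\<close>

lemma C_ball_jet:
  fixes F :: "'n::finite list \<Rightarrow> real ^ 'n \<Rightarrow> real"
  assumes F: "jet k F"
  shows "C_ball k (F [])"
  unfolding C_ball_def
proof (intro conjI allI impI ballI)
  fix "is" :: "'n list" and i and x :: "real ^ 'n"
  assume len: "length is < k" and x: "x \<in> ball 0 1"
  have "\<forall>\<^sub>F t in nhds 0. F is (x + t *\<^sub>R axis i 1) = partials is (F []) (x + t *\<^sub>R axis i 1)"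
    using eventually_line_in_ball[OF x, of "axis i 1"]
    by eventually_elim (use partials_jet[OF F] len in auto)
  then have "((\<lambda>t. partials is (F []) (x + t *\<^sub>R axis i 1)) has_real_derivative F (i # is) x) (at 0)"
    using jetD_deriv[OF F len x, of i] by (subst (asm) DERIV_cong_ev) auto
  then show "(\<lambda>t. partials is (F []) (x + t *\<^sub>R axis i 1)) differentiable at 0"
    using real_differentiable_def by blast
next
  fix "is" :: "'n list" assume len: "length is \<le> k"
  show "continuous_on (cball 0 1) (partials is (F []))"
    using jetD_cont[OF F len] partials_jet[OF F len]
    by (subst continuous_on_cong[OF refl]) auto
qed

text \<open>The opposite passage, from a given competitor to a jet, to which Taylor's formula is
  then applied.\<close>

lemma jet_partials:
  fixes f :: "real ^ 'n::finite \<Rightarrow> real"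
  assumes "C_ball k f"
  shows "jet k (\<lambda>is. partials is f)"
  unfolding jet_def
proof (intro conjI allI impI ballI)
  fix "is" :: "'n list" and i and x :: "real ^ 'n"
  assume len: "length is < k" and x: "x \<in> ball 0 1"
  have "(\<lambda>t. partials is f (x + t *\<^sub>R axis i 1)) field_differentiable at 0"
    using assms len x by (simp add: C_ball_def real_differentiable_def field_differentiable_def)
  moreover have "partials (i # is) f x = deriv (\<lambda>t. partials is f (x + t *\<^sub>R axis i 1)) 0"
    using x by (simp add: partials_def partial_deriv_def Let_def)
  ultimately show "((\<lambda>t. partials is f (x + t *\<^sub>R axis i 1))
      has_real_derivative partials (i # is) f x) (at 0)"
    by (simp add: DERIV_deriv_iff_field_differentiable)
next
  fix "is" :: "'n list" assume "length is \<le> k"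
  then show "continuous_on (cball 0 1) (partials is f)"
    using assms by (simp add: C_ball_def)
qed

text \<open>Differentiating along a ray puts one more index at the head of the list; this collects
  the result as a sum over longer lists.\<close>

lemma sum_lists_Suc:
  fixes h :: "'n::finite list \<Rightarrow> 'a::comm_monoid_add"
  shows "(\<Sum>is | length is = Suc l. h is) = (\<Sum>is | length is = l. \<Sum>i\<in>UNIV. h (i # is))"
proof -
  have "(\<Sum>is | length is = l. \<Sum>i\<in>UNIV. h (i # is))
      = (\<Sum>(is, i)\<in>{is. length is = l} \<times> UNIV. h (i # is))"
    by (simp add: sum.cartesian_product)
  also have "\<dots> = (\<Sum>is | length is = Suc l. h is)"
    by (rule sum.reindex_bij_witness[where i = "\<lambda>is. (tl is, hd is)" and j = "\<lambda>(is, i). i # is"])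
       (auto simp: length_Suc_conv)
  finally show ?thesis by simp
qed

section \<open>Suprema of the derivative norms\<close>

lemma continuous_on_deriv_norm:
  assumes "C_ball k f" and "l \<le> k"
  shows "continuous_on (cball 0 1) (deriv_norm l f)"
  unfolding deriv_norm_def using assms
  by (intro continuous_on_sum continuous_on_rabs) (simp add: C_ball_def)

lemma bdd_above_deriv_norm:
  assumes "C_ball k f" and "l \<le> k"
  shows "bdd_above (deriv_norm l f ` cball 0 1)"
  using continuous_on_deriv_norm[OF assms]
  by (intro bounded_imp_bdd_above compact_imp_bounded compact_continuous_image) auto

lemma deriv_norm_nonneg: "0 \<le> deriv_norm l f z"
  unfolding deriv_norm_def by (intro sum_nonneg) auto

lemma deriv_norm_0: "deriv_norm 0 f z = \<bar>f z\<bar>"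
  by (simp add: deriv_norm_def partials_def)

lemma deriv_norm_le_M:
  assumes "C_ball k f" and "l \<le> k" and "z \<in> cball 0 1"
  shows "deriv_norm l f z \<le> M l f"
  unfolding M_def using bdd_above_deriv_norm[OF assms(1,2)] assms(3) by (rule cSUP_upper2) auto

lemma M_le:
  assumes "\<And>z. z \<in> cball 0 1 \<Longrightarrow> deriv_norm l f z \<le> m"
  shows "M l f \<le> m"
  unfolding M_def using assms by (intro cSUP_least) auto

lemma M_nonneg:
  assumes "C_ball k f" and "l \<le> k"
  shows "0 \<le> M l f"
  using deriv_norm_le_M[OF assms, of 0] deriv_norm_nonneg[of l f 0] by simp

section \<open>Jets of products and polynomials\<close>

lemma jet_cmult:
  assumes F: "jet k F"
  shows "jet k (\<lambda>is x. c * F is x)"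
  unfolding jet_def
  by (intro conjI allI impI ballI DERIV_cmult jetD_deriv[OF F]
      continuous_on_mult_left jetD_cont[OF F])

lemma jet_diff:
  assumes F: "jet k F" and G: "jet k G"
  shows "jet k (\<lambda>is x. F is x - G is x)"
  unfolding jet_def
  by (intro conjI allI impI ballI DERIV_diff jetD_deriv[OF F] jetD_deriv[OF G]
      continuous_on_diff jetD_cont[OF F] jetD_cont[OF G])

lemma jet_sum:
  assumes F: "\<And>a. a \<in> A \<Longrightarrow> jet k (F a)"
  shows "jet k (\<lambda>is x. \<Sum>a\<in>A. F a is x)"
  unfolding jet_def
  by (intro conjI allI impI ballI DERIV_sum jetD_deriv[OF F]
      continuous_on_sum jetD_cont[OF F])

text \<open>The analogue of \<open>jet\<close> on the real line: \<open>D j\<close> plays the j-th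
  derivative of \<open>D 0\<close>.\<close>

definition tower :: "nat \<Rightarrow> (nat \<Rightarrow> real \<Rightarrow> real) \<Rightarrow> bool" where
  "tower k D \<longleftrightarrow> (\<forall>j<k. \<forall>t. (D j has_real_derivative D (Suc j) t) (at t)) \<and>
     continuous_on UNIV (D k)"

lemma towerD_cont:
  assumes "tower k D" and "j \<le> k"
  shows "continuous_on UNIV (D j)"
proof (cases "j = k")
  case False
  then have "\<forall>t. (D j has_real_derivative D (Suc j) t) (at t)"
    using assms by (simp add: tower_def)
  then show ?thesis
    using DERIV_isCont continuous_at_imp_continuous_on by blast
qed (use assms in \<open>simp add: tower_def\<close>)

text \<open>A derivative in direction i acts on the i-th factor alone, so the order reached in that
  factor is the number of occurrences of i in the list. Monomials and bumps are both products of
  this kind.\<close>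

lemma jet_prod:
  fixes D :: "'n::finite \<Rightarrow> nat \<Rightarrow> real \<Rightarrow> real"
  assumes D: "\<And>i. tower k (D i)"
  shows "jet k (\<lambda>is x. \<Prod>i\<in>UNIV. D i (count_list is i) (x $ i))"
  unfolding jet_def
proof (intro conjI allI impI ballI)
  fix "is" :: "'n list" and i and x :: "real ^ 'n"
  assume len: "length is < k"
  define c where "c = (\<Prod>j\<in>UNIV - {i}. D j (count_list is j) (x $ j))"
  have prod: "(\<Prod>j\<in>UNIV. D j (count_list is' j) ((x + t *\<^sub>R axis i 1) $ j))
      = D i (count_list is' i) (x $ i + t) * c"
    if "\<And>j. j \<noteq> i \<Longrightarrow> count_list is' j = count_list is j" for t is'
  proof -
    have "(\<Prod>j\<in>UNIV. D j (count_list is' j) ((x + t *\<^sub>R axis i 1) $ j))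
        = D i (count_list is' i) ((x + t *\<^sub>R axis i 1) $ i)
          * (\<Prod>j\<in>UNIV - {i}. D j (count_list is' j) ((x + t *\<^sub>R axis i 1) $ j))"
      by (rule prod.remove) auto
    also have "(\<Prod>j\<in>UNIV - {i}. D j (count_list is' j) ((x + t *\<^sub>R axis i 1) $ j)) = c"
      unfolding c_def by (rule prod.cong) (simp_all add: that axis_def)
    finally show ?thesis by (simp add: axis_def)
  qed
  have "count_list is i < k"
    using len count_le_length[of "is" i] by simp
  then have "(D i (count_list is i) has_real_derivative D i (Suc (count_list is i)) (x $ i + 0)) (at (x $ i + 0))"
    using D[of i] by (simp add: tower_def)
  moreover have "((\<lambda>t. x $ i + t) has_real_derivative 1) (at 0)"
    by (auto intro!: derivative_eq_intros)
  ultimately have "((\<lambda>t. D i (count_list is i) (x $ i + t)) has_real_derivative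
      D i (Suc (count_list is i)) (x $ i + 0) * 1) (at 0)"
    by (rule DERIV_chain2)
  then have deriv: "((\<lambda>t. D i (count_list is i) (x $ i + t) * c) has_real_derivative
      D i (Suc (count_list is i)) (x $ i + 0) * 1 * c) (at 0)"
    by (rule DERIV_cmult_right)
  have fun_eq: "(\<lambda>t. \<Prod>j\<in>UNIV. D j (count_list is j) ((x + t *\<^sub>R axis i 1) $ j))
      = (\<lambda>t. D i (count_list is i) (x $ i + t) * c)"
    by (rule ext, rule prod) (rule refl)
  have val_eq: "(\<Prod>j\<in>UNIV. D j (count_list (i # is) j) (x $ j))
      = D i (Suc (count_list is i)) (x $ i + 0) * 1 * c"
    using prod[of "i # is" 0] by simp
  show "((\<lambda>t. \<Prod>j\<in>UNIV. D j (count_list is j) ((x + t *\<^sub>R axis i 1) $ j)) has_real_derivative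
      (\<Prod>j\<in>UNIV. D j (count_list (i # is) j) (x $ j))) (at 0)"
    by (subst fun_eq, subst val_eq) (rule deriv)
next
  fix "is" :: "'n list"
  assume len: "length is \<le> k"
  have "continuous_on (cball 0 1) (\<lambda>x. D i (count_list is i) (x $ i))" for i
  proof -
    have "continuous_on UNIV (D i (count_list is i))"
      using towerD_cont[OF D] len count_le_length[of "is" i] by simp
    then show ?thesis
      by (rule continuous_on_compose2) (auto intro!: continuous_on_component continuous_on_id)
  qed
  then show "continuous_on (cball 0 1) (\<lambda>x. \<Prod>i\<in>UNIV. D i (count_list is i) (x $ i))"
    by (rule continuous_on_prod)
qed

lemma tower_poly: "tower k (\<lambda>j. poly ((pderiv ^^ j) p))"
  by (auto simp: tower_def intro: poly_DERIV continuous_intros)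

text \<open>Each differentiation contributes a factor 1 / r by the chain rule; this is the origin of
  the power of \<rho> in the upper bound.\<close>

lemma tower_affine:
  assumes "tower k D" and "r \<noteq> 0"
  shows "tower k (\<lambda>j t. D j ((t - a) / r) / r ^ j)"
  unfolding tower_def
proof (intro conjI allI impI)
  fix j t assume "j < k"
  then have "(D j has_real_derivative D (Suc j) ((t - a) / r)) (at ((t - a) / r))"
    using assms(1) by (simp add: tower_def)
  moreover have "((\<lambda>t. (t - a) / r) has_real_derivative 1 / r) (at t)"
    using assms(2) by (auto intro!: derivative_eq_intros)
  ultimately have "((\<lambda>t. D j ((t - a) / r)) has_real_derivative D (Suc j) ((t - a) / r) * (1 / r)) (at t)"
    by (rule DERIV_chain2)
  then have "((\<lambda>t. D j ((t - a) / r) / r ^ j) has_real_derivative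
      D (Suc j) ((t - a) / r) * (1 / r) / r ^ j) (at t)"
    by (rule DERIV_cdivide)
  then show "((\<lambda>t. D j ((t - a) / r) / r ^ j) has_real_derivative
      D (Suc j) ((t - a) / r) / r ^ Suc j) (at t)"
    by (simp add: mult.commute)
next
  have "continuous_on UNIV (\<lambda>t. D k ((t - a) * inverse r))"
    using towerD_cont[OF assms(1), of k]
    by (rule continuous_on_compose2) (auto intro!: continuous_intros)
  then show "continuous_on UNIV (\<lambda>t. D k ((t - a) / r) / r ^ k)"
    unfolding divide_inverse by (intro continuous_on_mult_right)
qed

text \<open>Each differentiation lowers the degree by one, so \<open>j - 1\<close> of them leave a
  constant, which the last one kills.\<close>

lemma higher_pderiv_eq_0:
  fixes p :: "real poly"
  assumes "degree p < j"
  shows "(pderiv ^^ j) p = 0"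
proof -
  have "degree ((pderiv ^^ m) p) = degree p - m" for m
    by (induction m) (auto simp: degree_pderiv)
  then have "degree ((pderiv ^^ (j - 1)) p) = 0"
    using assms by simp
  then have "pderiv ((pderiv ^^ (j - 1)) p) = 0"
    by (simp add: pderiv_eq_0_iff)
  then show ?thesis
    using assms by (cases j) auto
qed

lemma sum_count_list: "(\<Sum>i\<in>UNIV. count_list is i) = length (is :: 'n::finite list)"
  using sum_count_set[of "is" UNIV] by simp

text \<open>The derivatives beyond order d vanish by counting: in each monomial some variable is
  differentiated more often than its exponent allows.\<close>

lemma poly_fun_le_jet:
  fixes P :: "real ^ 'n::finite \<Rightarrow> real"
  assumes "P \<in> poly_fun_le d"
  obtains F where "jet k F" "F [] = P" "\<And>is x. d < length is \<Longrightarrow> F is x = 0"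
proof -
  obtain c where c: "P = (\<lambda>x. \<Sum>\<alpha> | (\<Sum>i\<in>UNIV. \<alpha> i) \<le> d. c \<alpha> * (\<Prod>i\<in>UNIV. (x $ i) ^ \<alpha> i))"
    using assms by (auto simp: poly_fun_le_def)
  define F where "F = (\<lambda>is x. \<Sum>\<alpha> | (\<Sum>i\<in>UNIV. \<alpha> i) \<le> d.
    c \<alpha> * (\<Prod>i\<in>UNIV. poly ((pderiv ^^ count_list is i) (monom 1 (\<alpha> i))) (x $ i)))"
  show ?thesis
  proof
    show "jet k F"
      unfolding F_def by (intro jet_sum jet_cmult jet_prod tower_poly)
    show "F [] = P"
      by (simp add: F_def c poly_monom)
    show "F is x = 0" if "d < length is" for "is" x
    proof -
      have "\<exists>i. (pderiv ^^ count_list is i) (monom (1::real) (\<alpha> i)) = 0"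
        if \<alpha>: "(\<Sum>i\<in>UNIV. \<alpha> i) \<le> d" for \<alpha> :: "'n \<Rightarrow> nat"
      proof -
        have "\<exists>i. \<alpha> i < count_list is i"
        proof (rule ccontr)
          assume "\<nexists>i. \<alpha> i < count_list is i"
          then have "(\<Sum>i\<in>UNIV. count_list is i) \<le> (\<Sum>i\<in>UNIV. \<alpha> i)"
            by (intro sum_mono) (simp add: not_less)
          then show False
            using \<alpha> \<open>d < length is\<close> by (simp add: sum_count_list)
        qed
        then show ?thesis
          using higher_pderiv_eq_0 by (metis degree_monom_eq one_neq_zero)
      qed
      then have "(\<Prod>i\<in>UNIV. poly ((pderiv ^^ count_list is i) (monom 1 (\<alpha> i))) (x $ i)) = 0"
        if "(\<Sum>i\<in>UNIV. \<alpha> i) \<le> d" for \<alpha> :: "'n \<Rightarrow> nat"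
        using that by (metis (no_types, lifting) UNIV_I finite poly_0 prod_zero)
      then show ?thesis
        unfolding F_def by (intro sum.neutral) simp
    qed
  qed
qed

section \<open>Closure properties of the polynomials of degree at most d\<close>

lemma poly_fun_le_monom:
  assumes "(\<Sum>i\<in>UNIV. \<beta> i) \<le> d"
  shows "(\<lambda>x::real ^ 'n::finite. \<Prod>i\<in>UNIV. (x $ i) ^ \<beta> i) \<in> poly_fun_le d"
proof -
  have "(\<Prod>i\<in>UNIV. (x $ i) ^ \<beta> i) = (\<Sum>\<alpha> | (\<Sum>i\<in>UNIV. \<alpha> i) \<le> d.
      (if \<alpha> = \<beta> then 1 else 0) * (\<Prod>i\<in>UNIV. (x $ i) ^ \<alpha> i))" for x :: "real ^ 'n"
    using assms finite_multi_indices[where 'n='n, of d]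
    by (subst sum.remove[of _ \<beta>]) (auto intro!: sum.neutral)
  then show ?thesis
    unfolding poly_fun_le_def by (intro CollectI exI[of _ "\<lambda>\<alpha>. if \<alpha> = \<beta> then 1 else 0"] ext)
qed

lemma poly_fun_le_cmult:
  assumes "P \<in> poly_fun_le d"
  shows "(\<lambda>x. a * P x) \<in> poly_fun_le d"
proof -
  obtain c where "P = (\<lambda>x. \<Sum>\<alpha> | (\<Sum>i\<in>UNIV. \<alpha> i) \<le> d. c \<alpha> * (\<Prod>i\<in>UNIV. (x $ i) ^ \<alpha> i))"
    using assms by (auto simp: poly_fun_le_def)
  then have "(\<lambda>x. a * P x) = (\<lambda>x. \<Sum>\<alpha> | (\<Sum>i\<in>UNIV. \<alpha> i) \<le> d.
      (a * c \<alpha>) * (\<Prod>i\<in>UNIV. (x $ i) ^ \<alpha> i))"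
    by (simp add: sum_distrib_left mult.assoc)
  then show ?thesis
    unfolding poly_fun_le_def by (intro CollectI exI)
qed

lemma poly_fun_le_add:
  assumes "P \<in> poly_fun_le d" and "Q \<in> poly_fun_le d"
  shows "(\<lambda>x. P x + Q x) \<in> poly_fun_le d"
proof -
  obtain c e where
    "P = (\<lambda>x. \<Sum>\<alpha> | (\<Sum>i\<in>UNIV. \<alpha> i) \<le> d. c \<alpha> * (\<Prod>i\<in>UNIV. (x $ i) ^ \<alpha> i))"
    "Q = (\<lambda>x. \<Sum>\<alpha> | (\<Sum>i\<in>UNIV. \<alpha> i) \<le> d. e \<alpha> * (\<Prod>i\<in>UNIV. (x $ i) ^ \<alpha> i))"
    using assms by (auto simp: poly_fun_le_def)
  then have "(\<lambda>x. P x + Q x) = (\<lambda>x. \<Sum>\<alpha> | (\<Sum>i\<in>UNIV. \<alpha> i) \<le> d.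
      (c \<alpha> + e \<alpha>) * (\<Prod>i\<in>UNIV. (x $ i) ^ \<alpha> i))"
    by (simp add: sum.distrib distrib_right)
  then show ?thesis
    unfolding poly_fun_le_def by (intro CollectI exI)
qed

lemma poly_fun_le_const: "(\<lambda>x::real ^ 'n::finite. a) \<in> poly_fun_le d"
  using poly_fun_le_cmult[OF poly_fun_le_monom[where \<beta>="\<lambda>_::'n. 0" and d=d], of a] by simp

lemma poly_fun_le_sum:
  assumes "\<And>a. a \<in> A \<Longrightarrow> P a \<in> poly_fun_le d"
  shows "(\<lambda>x. \<Sum>a\<in>A. P a x) \<in> poly_fun_le d"
  using assms
proof (induction A rule: infinite_finite_induct)
  case (insert a A)
  then show ?case
    using poly_fun_le_add[of "P a" d "\<lambda>x. \<Sum>a\<in>A. P a x"] by simp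
qed (simp_all add: poly_fun_le_const)

lemma prod_list_eq_prod_count:
  "prod_list (map h is) = (\<Prod>i\<in>UNIV. h i ^ count_list is i)"
  for h :: "'n::finite \<Rightarrow> 'a::comm_monoid_mult"
proof (induction "is")
  case (Cons j "is")
  have "(\<Prod>i\<in>UNIV. h i ^ count_list (j # is) i)
      = (\<Prod>i\<in>UNIV. (if i = j then h i else 1) * h i ^ count_list is i)"
    by (intro prod.cong) auto
  then show ?case
    using Cons by (simp add: prod.distrib)
qed simp

text \<open>The Taylor polynomial is a sum over index lists; grouping equal indices turns each of
  its products into a monomial.\<close>

lemma poly_fun_le_prod_list:
  assumes "length is \<le> d"
  shows "(\<lambda>x::real ^ 'n::finite. prod_list (map (($) x) is)) \<in> poly_fun_le d"
  unfolding prod_list_eq_prod_count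
  by (rule poly_fun_le_monom[where \<beta> = "count_list is"]) (simp add: sum_count_list assms)

lemma poly_fun_le_continuous:
  assumes "P \<in> poly_fun_le d"
  shows "continuous_on S P"
proof -
  obtain c where "P = (\<lambda>x. \<Sum>\<alpha> | (\<Sum>i\<in>UNIV. \<alpha> i) \<le> d. c \<alpha> * (\<Prod>i\<in>UNIV. (x $ i) ^ \<alpha> i))"
    using assms by (auto simp: poly_fun_le_def)
  then show ?thesis
    by (simp only:) (intro continuous_on_sum continuous_on_mult_left continuous_on_prod
        continuous_on_power continuous_on_component continuous_on_id)
qed

section \<open>Bump functions\<close>

text \<open>By the product rule a differentiation costs at most one factor q. Iterated below, this
  controls the zeros of the bump at the end points.\<close>

lemma power_dvd_pderiv:
  fixes q :: "real poly"
  assumes "q ^ Suc n dvd r"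
  shows "q ^ n dvd pderiv r"
proof -
  obtain s where "r = q ^ Suc n * s"
    using assms dvdE by blast
  then have "pderiv r = q ^ Suc n * pderiv s + s * (smult (of_nat (Suc n)) (q ^ n) * pderiv q)"
    by (simp only: pderiv_mult pderiv_power_Suc)
  moreover have "q ^ n dvd q ^ Suc n"
    by (rule le_imp_power_dvd) simp
  ultimately show ?thesis
    by (simp del: power_Suc add: dvd_add dvd_mult dvd_mult2 dvd_smult)
qed

lemma power_dvd_higher_pderiv:
  fixes q :: "real poly"
  assumes "j \<le> m"
  shows "q ^ (m - j) dvd (pderiv ^^ j) (q ^ m)"
  using assms
proof (induction j)
  case (Suc j)
  then have "q ^ Suc (m - Suc j) dvd (pderiv ^^ j) (q ^ m)"
    by (simp add: Suc_diff_Suc del: power_Suc)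
  then show ?case
    using power_dvd_pderiv by simp
qed simp

definition cutoff :: "real poly \<Rightarrow> real \<Rightarrow> real" where
  "cutoff p t = (if \<bar>t\<bar> \<le> 1 then poly p t else 0)"

text \<open>Only the end points need an argument: there the difference quotient of the cutoff is
  dominated by that of p, which tends to 0.\<close>

lemma cutoff_has_real_derivative:
  assumes zero: "\<And>s. \<bar>s\<bar> = 1 \<Longrightarrow> poly p s = 0" "\<And>s. \<bar>s\<bar> = 1 \<Longrightarrow> poly (pderiv p) s = 0"
  shows "(cutoff p has_real_derivative cutoff (pderiv p) t) (at t)"
proof -
  have poly: "(poly p has_real_derivative poly (pderiv p) t) (at t)"
    by (rule poly_DERIV)
  consider "\<bar>t\<bar> < 1" | "\<bar>t\<bar> = 1" | "1 < \<bar>t\<bar>" by linarith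
  then show ?thesis
  proof cases
    case 1
    have "(cutoff p has_real_derivative poly (pderiv p) t) (at t)"
      by (rule has_field_derivative_transform_within_open[OF poly, of "{-1<..<1}"])
         (use 1 in \<open>auto simp: cutoff_def\<close>)
    then show ?thesis
      using 1 by (simp add: cutoff_def)
  next
    case 2
    have "((\<lambda>s. (poly p s - poly p t) / (s - t)) \<longlongrightarrow> 0) (at t)"
      using poly zero(2)[OF 2] by (simp add: has_field_derivative_iff)
    then have lim: "((\<lambda>s. \<bar>(poly p s - poly p t) / (s - t)\<bar>) \<longlongrightarrow> 0) (at t)"
      by (rule tendsto_rabs_zero)
    have "norm ((cutoff p s - cutoff p t) / (s - t)) \<le> \<bar>(poly p s - poly p t) / (s - t)\<bar>" for s
      using zero(1)[OF 2] 2 by (simp add: cutoff_def)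
    then have "((\<lambda>s. (cutoff p s - cutoff p t) / (s - t)) \<longlongrightarrow> 0) (at t)"
      by (intro Lim_null_comparison[OF always_eventually lim] allI)
    then show ?thesis
      using zero(2)[OF 2] 2 by (simp add: has_field_derivative_iff cutoff_def)
  next
    case 3
    have "((\<lambda>_. 0) has_real_derivative 0) (at t)"
      by (rule DERIV_const)
    then have "(cutoff p has_real_derivative 0) (at t)"
      by (rule has_field_derivative_transform_within_open[of _ _ _ "- {-1..1}"])
         (use 3 in \<open>auto simp: cutoff_def\<close>)
    then show ?thesis
      using 3 by (simp add: cutoff_def)
  qed
qed

lemma continuous_on_cutoff:
  assumes "\<And>s. \<bar>s\<bar> = 1 \<Longrightarrow> poly p s = 0"
  shows "continuous_on UNIV (cutoff p)"
proof -
  have "continuous_on ({-1..1} \<union> ({..-1} \<union> {1..})) (\<lambda>t. if t \<in> {-1..1} then poly p t else 0)"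
  proof (rule continuous_on_cases)
    show "\<forall>x. x \<in> {-1..1} \<and> x \<notin> {-1..1} \<or> x \<in> {..-1} \<union> {1..} \<and> x \<in> {-1..1} \<longrightarrow> poly p x = 0"
      using assms by force
  qed (auto intro!: closed_Un continuous_on_poly continuous_on_id)
  moreover have "{-1..1} \<union> ({..-1} \<union> {1..}) = (UNIV :: real set)"
    by auto
  moreover have "cutoff p = (\<lambda>t. if t \<in> {-1..1} then poly p t else 0)"
    by (auto simp: cutoff_def fun_eq_iff)
  ultimately show ?thesis by (simp only:)
qed

lemma continuous_compact_support_bounded:
  fixes g :: "real \<Rightarrow> real"
  assumes "continuous_on UNIV g" and "\<And>t. 1 \<le> \<bar>t\<bar> \<Longrightarrow> g t = 0"
  shows "\<exists>b\<ge>0. \<forall>t. \<bar>g t\<bar> \<le> b"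
proof -
  have "compact (g ` {-1..1})"
    using continuous_on_subset[OF assms(1), of "{-1..1}"] by (intro compact_continuous_image) auto
  then obtain b where b: "\<forall>y\<in>g ` {-1..1}. norm y \<le> b"
    using compact_imp_bounded bounded_iff[of "g ` {-1..1}"] by blast
  have "\<bar>g t\<bar> \<le> max b 0" for t
  proof (cases "\<bar>t\<bar> \<le> 1")
    case True
    then have "g t \<in> g ` {-1..1}" by (intro imageI) auto
    then have "norm (g t) \<le> b" using b by blast
    then show ?thesis by simp
  next
    case False
    then show ?thesis using assms(2)[of t] by simp
  qed
  then show ?thesis by (intro exI[of _ "max b 0"]) auto
qed

lemma bump_tower:
  obtains D B where "tower k D" "D 0 0 = 1" "\<And>t. 0 \<le> D 0 t \<and> D 0 t \<le> 1"
    "\<And>j t. 1 \<le> \<bar>t\<bar> \<Longrightarrow> j \<le> k \<Longrightarrow> D j t = 0"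
    "1 \<le> B" "\<And>j t. j \<le> k \<Longrightarrow> \<bar>D j t\<bar> \<le> B"
proof -
  \<comment> \<open>The bump is \<open>(1 - t\<^sup>2)^(k + 1)\<close> on [-1, 1]; its derivatives up to order k vanish at the end points.\<close>
  define q :: "real poly" where "q = [:1, 0, -1:]"
  define p where "p = q ^ Suc k"
  define D where "D = (\<lambda>j. cutoff ((pderiv ^^ j) p))"
  have q: "poly q t = 1 - t\<^sup>2" for t
    by (simp add: q_def power2_eq_square)
  have zero: "poly ((pderiv ^^ j) p) t = 0" if j: "j \<le> k" and t: "\<bar>t\<bar> = 1" for j t
  proof -
    have "q ^ (Suc k - j) dvd (pderiv ^^ j) p"
      unfolding p_def using j by (intro power_dvd_higher_pderiv) simp
    then obtain s where "(pderiv ^^ j) p = q ^ (Suc k - j) * s"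
      using dvdE by blast
    moreover have "t\<^sup>2 = 1"
      using t by (metis one_power2 power2_abs)
    \<comment> \<open>As j is at most k, the exponent is at least 1, so the vanishing factor 1 -
      \<open>t\<^sup>2\<close> is really present.\<close>
    ultimately show ?thesis
      using j by (simp add: q power_0_left)
  qed
  have tower: "tower k D"
    unfolding tower_def
  proof (intro conjI allI impI)
    fix j t assume "j < k"
    then have "(cutoff ((pderiv ^^ j) p) has_real_derivative cutoff (pderiv ((pderiv ^^ j) p)) t) (at t)"
      using zero[of j] zero[of "Suc j"] by (intro cutoff_has_real_derivative) simp_all
    then show "(D j has_real_derivative D (Suc j) t) (at t)"
      by (simp add: D_def)
  next
    show "continuous_on UNIV (D k)"
      unfolding D_def using zero[of k] by (intro continuous_on_cutoff) simp
  qed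
  have outside: "D j t = 0" if "1 \<le> \<bar>t\<bar>" "j \<le> k" for j t
    using that zero[of j t] by (auto simp: D_def cutoff_def)
  have "\<exists>b. 0 \<le> b \<and> (\<forall>t. \<bar>D j t\<bar> \<le> b)" if "j \<in> {..k}" for j
    using that by (intro continuous_compact_support_bounded towerD_cont[OF tower] outside) auto
  then have "\<exists>b. \<forall>j\<in>{..k}. 0 \<le> b j \<and> (\<forall>t. \<bar>D j t\<bar> \<le> b j)"
    by (intro bchoice) auto
  then obtain b where b: "\<And>j. j \<in> {..k} \<Longrightarrow> 0 \<le> b j" "\<And>j t. j \<in> {..k} \<Longrightarrow> \<bar>D j t\<bar> \<le> b j"
    by auto
  \<comment> \<open>One bound for all orders up to k; the summand 1 ensures
    \<open>1 \<le> B\<close>.\<close>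
  define B where "B = 1 + (\<Sum>j\<le>k. b j)"
  have bB: "b j \<le> (\<Sum>j\<le>k. b j)" if "j \<in> {..k}" for j
    using that b(1) by (intro member_le_sum) auto
  show ?thesis
  proof
    show "tower k D" by (rule tower)
    show "D 0 0 = 1" by (simp add: D_def cutoff_def p_def q_def)
    show "0 \<le> D 0 t \<and> D 0 t \<le> 1" for t
    proof (cases "\<bar>t\<bar> \<le> 1")
      case True
      then have "0 \<le> 1 - t\<^sup>2" "1 - t\<^sup>2 \<le> 1"
        by (simp_all add: abs_square_le_1)
      then have "0 \<le> (1 - t\<^sup>2) ^ Suc k \<and> (1 - t\<^sup>2) ^ Suc k \<le> 1"
        by (intro conjI zero_le_power power_le_one)
      then show ?thesis
        using True by (simp add: D_def cutoff_def p_def q poly_power del: power_Suc)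
    qed (simp add: D_def cutoff_def)
    show "1 \<le> B" unfolding B_def using sum_nonneg[of "{..k}" b] b(1) by simp
    show "\<bar>D j t\<bar> \<le> B" if "j \<le> k" for j t
      using b(2)[of j t] bB[of j] that by (simp add: B_def)
  qed (rule outside)
qed

section \<open>Taylor approximation\<close>

text \<open>Coordinates are moved one at a time, each step being controlled by the mean value theorem.\<close>

lemma has_derivative_of_partials:
  fixes f :: "real ^ 'n::finite \<Rightarrow> real"
  assumes S: "open S" "x \<in> S"
    and deriv: "\<And>i y. y \<in> S \<Longrightarrow>
      ((\<lambda>t. f (y + t *\<^sub>R axis i 1)) has_real_derivative g i y) (at 0)"
    and cont: "\<And>i. isCont (g i) x"
  shows "(f has_derivative (\<lambda>h. \<Sum>i\<in>UNIV. h $ i * g i x)) (at x)"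
  unfolding has_derivative_at_alt
proof (intro conjI allI impI)
  show "bounded_linear (\<lambda>h. \<Sum>i\<in>UNIV. h $ i * g i x)"
    by (intro bounded_linear_sum bounded_linear_mult_const bounded_linear_vec_nth)
next
  fix e :: real assume "0 < e"
  \<comment> \<open>There is one error term per coordinate, each at most \<epsilon> times the norm
    of the increment.\<close>
  define \<epsilon> where "\<epsilon> = e / real CARD('n)"
  have \<epsilon>: "0 < \<epsilon>"
    using \<open>0 < e\<close> by (simp add: \<epsilon>_def)
  have "\<forall>\<^sub>F y in nhds x. y \<in> S \<and> (\<forall>i\<in>UNIV. dist (g i y) (g i x) < \<epsilon>)"
  proof (intro eventually_conj eventually_ball_finite ballI)
    show "\<forall>\<^sub>F y in nhds x. y \<in> S"
      using S by (rule eventually_nhds_in_open)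
    show "\<forall>\<^sub>F y in nhds x. dist (g i y) (g i x) < \<epsilon>" for i
      using cont[of i] \<epsilon> unfolding isCont_def tendsto_at_iff_tendsto_nhds by (rule tendstoD)
  qed simp
  then obtain d where d: "0 < d"
    "\<And>y. dist y x < d \<Longrightarrow> y \<in> S \<and> (\<forall>i\<in>UNIV. dist (g i y) (g i x) < \<epsilon>)"
    unfolding eventually_nhds_metric by blast
  have "norm (f y - f x - (\<Sum>i\<in>UNIV. (y - x) $ i * g i x)) \<le> e * norm (y - x)"
    if y: "norm (y - x) < d" for y
  proof -
    define h where "h = y - x"
    \<comment> \<open>The increment with only the coordinates in A already moved. All intermediate
      points stay within \<open>norm h\<close> of x, hence in the region where the partial
      derivatives are controlled.\<close>
    define v where "v = (\<lambda>A. \<chi> i. if i \<in> A then h $ i else 0)"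
    have near: "dist (x + v A + s *\<^sub>R axis j 1) x < d"
      if "j \<notin> A" "s \<in> closed_segment 0 (h $ j)" for A j s
    proof -
      have "\<bar>s\<bar> \<le> \<bar>h $ j\<bar>"
        using that(2) by (auto simp: closed_segment_eq_real_ivl split: if_splits)
      then have "norm (v A + s *\<^sub>R axis j 1) \<le> norm h"
        using that(1) by (intro norm_le_componentwise_cart) (auto simp: v_def axis_def)
      then show ?thesis
        using y by (simp add: dist_norm h_def algebra_simps)
    qed
    have approx: "\<bar>f (x + v A) - f x - (\<Sum>i\<in>A. h $ i * g i x)\<bar> \<le> (\<Sum>i\<in>A. \<epsilon> * \<bar>h $ i\<bar>)" for A
    proof (induction A rule: infinite_finite_induct)
      case empty
      have "v {} = 0" by (simp add: v_def vec_eq_iff)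
      then show ?case by simp
    next
      case (insert j A)
      \<comment> \<open>With the linear part removed, the derivative is at most \<epsilon> in
        absolute value along the step.\<close>
      define \<psi> where "\<psi> = (\<lambda>s. f (x + v A + s *\<^sub>R axis j 1) - s * g j x)"
      have v: "v (insert j A) = v A + (h $ j) *\<^sub>R axis j 1"
        using insert(2) by (auto simp: v_def vec_eq_iff axis_def)
      have "norm (\<psi> (h $ j) - \<psi> 0) \<le> \<epsilon> * norm (h $ j - 0)"
      proof (rule field_differentiable_bound)
        show "(\<psi> has_field_derivative g j (x + v A + s *\<^sub>R axis j 1) - g j x)
            (at s within closed_segment 0 (h $ j))"
          if s: "s \<in> closed_segment 0 (h $ j)" for s
        proof -
          have "((\<lambda>t. f (x + v A + s *\<^sub>R axis j 1 + t *\<^sub>R axis j 1)) has_real_derivative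
              g j (x + v A + s *\<^sub>R axis j 1)) (at 0)"
            using d(2)[OF near[OF insert(2) s]] by (intro deriv) simp
          moreover have "(\<lambda>t. f (x + v A + s *\<^sub>R axis j 1 + t *\<^sub>R axis j 1))
              = (\<lambda>t. f (x + v A + (t + s) *\<^sub>R axis j 1))"
            by (simp add: algebra_simps)
          ultimately have "((\<lambda>t. f (x + v A + t *\<^sub>R axis j 1)) has_real_derivative
              g j (x + v A + s *\<^sub>R axis j 1)) (at (0 + s))"
            by (simp only: DERIV_shift)
          then have "((\<lambda>t. f (x + v A + t *\<^sub>R axis j 1)) has_real_derivative
              g j (x + v A + s *\<^sub>R axis j 1)) (at s)"
            by simp
          moreover have "((\<lambda>t. t * g j x) has_real_derivative g j x) (at s)"
            using DERIV_cmult_right[OF DERIV_ident, of "g j x" s] by simp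
          ultimately show ?thesis
            unfolding \<psi>_def by (rule DERIV_diff[THEN has_field_derivative_at_within])
        qed
        show "norm (g j (x + v A + s *\<^sub>R axis j 1) - g j x) \<le> \<epsilon>"
          if s: "s \<in> closed_segment 0 (h $ j)" for s
          using d(2)[OF near[OF insert(2) s]] by (simp add: dist_real_def less_imp_le)
      qed simp_all
      then have "\<bar>f (x + v (insert j A)) - f (x + v A) - h $ j * g j x\<bar> \<le> \<epsilon> * \<bar>h $ j\<bar>"
        by (simp add: \<psi>_def v add.assoc)
      then show ?case
        using insert by simp
    qed simp
    have "v UNIV = h" by (simp add: v_def)
    then have "\<bar>f (x + h) - f x - (\<Sum>i\<in>UNIV. h $ i * g i x)\<bar> \<le> (\<Sum>i\<in>UNIV. \<epsilon> * \<bar>h $ i\<bar>)"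
      using approx[of UNIV] by (simp only:)
    also have "\<dots> \<le> (\<Sum>i\<in>(UNIV :: 'n set). \<epsilon> * norm h)"
      using \<epsilon> by (intro sum_mono mult_left_mono component_le_norm_cart) simp
    also have "\<dots> = e * norm h"
      by (simp add: \<epsilon>_def)
    finally show ?thesis
      by (simp add: h_def)
  qed
  then show "\<exists>d>0. \<forall>y. norm (y - x) < d \<longrightarrow>
      norm (f y - f x - (\<Sum>i\<in>UNIV. (y - x) $ i * g i x)) \<le> e * norm (y - x)"
    using d(1) by blast
qed

text \<open>Continuity of the partial derivatives gives total differentiability inside the ball, and
  the chain rule applies. This reduces Taylor's formula to one variable.\<close>

lemma jet_deriv_ray:
  fixes x :: "real ^ 'n::finite"
  assumes F: "jet k F" and len: "length is < k" and x: "t *\<^sub>R x \<in> ball 0 1"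
  shows "((\<lambda>t. F is (t *\<^sub>R x)) has_real_derivative
    (\<Sum>i\<in>UNIV. x $ i * F (i # is) (t *\<^sub>R x))) (at t)"
proof -
  have "isCont (F (i # is)) (t *\<^sub>R x)" for i
    using continuous_on_subset[OF jetD_cont[OF F, of "i # is"] ball_subset_cball] len x
    by (auto simp: continuous_on_eq_continuous_at)
  then have "(F is has_derivative (\<lambda>h. \<Sum>i\<in>UNIV. h $ i * F (i # is) (t *\<^sub>R x))) (at (t *\<^sub>R x))"
    using x jetD_deriv[OF F len] by (intro has_derivative_of_partials[of "ball 0 1"]) auto
  then have "((\<lambda>t. F is (t *\<^sub>R x)) has_derivative
      (\<lambda>s. \<Sum>i\<in>UNIV. (s *\<^sub>R x) $ i * F (i # is) (t *\<^sub>R x))) (at t)"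
    by (rule has_derivative_compose[rotated]) (intro has_derivative_scaleR_left has_derivative_ident)
  moreover have "(\<lambda>s. \<Sum>i\<in>UNIV. (s *\<^sub>R x) $ i * F (i # is) (t *\<^sub>R x))
      = (*) (\<Sum>i\<in>UNIV. x $ i * F (i # is) (t *\<^sub>R x))"
    by (simp add: fun_eq_iff sum_distrib_left mult_ac)
  ultimately show ?thesis
    by (simp only: has_field_derivative_def)
qed

lemma abs_prod_list_le_1:
  fixes x :: "real ^ 'n::finite"
  assumes "x \<in> cball 0 1"
  shows "\<bar>prod_list (map (($) x) is)\<bar> \<le> 1"
proof (induction "is")
  case (Cons i "is")
  have "\<bar>x $ i\<bar> \<le> 1"
    using component_le_norm_cart[of x i] assms by simp
  then show ?case
    using Cons by (simp add: abs_mult mult_le_one)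
qed simp

text \<open>Maclaurin's formula along the ray from 0 to x. The products of coordinates in the
  remainder are at most 1 on the ball, so the sum norm of the derivatives bounds it with no further
  constant.\<close>

lemma jet_taylor:
  fixes F :: "'n::finite list \<Rightarrow> real ^ 'n \<Rightarrow> real"
  assumes F: "jet (Suc d) F"
    and m: "\<And>z. z \<in> cball 0 1 \<Longrightarrow> (\<Sum>is | length is = Suc d. \<bar>F is z\<bar>) \<le> m"
  obtains P where "P \<in> poly_fun_le d"
    "\<And>x. x \<in> cball 0 1 \<Longrightarrow> \<bar>F [] x - P x\<bar> \<le> m / fact (Suc d)"
proof -
  define P where "P = (\<lambda>x. \<Sum>j<Suc d. \<Sum>is | length is = j.
    F is 0 / fact j * prod_list (map (($) x) is))"
  have P: "P \<in> poly_fun_le d"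
    unfolding P_def by (intro poly_fun_le_sum poly_fun_le_cmult poly_fun_le_prod_list) auto
  have ball: "\<bar>F [] x - P x\<bar> \<le> m / fact (Suc d)" if x: "x \<in> ball 0 1" for x
  proof -
    \<comment> \<open>\<open>H j\<close> is the j-th derivative of \<open>H 0\<close> on [0, 1],
      where \<open>H 0 t = F [] (t *\<^sub>R x)\<close>.\<close>
    define H where "H = (\<lambda>j t. \<Sum>is | length is = j. F is (t *\<^sub>R x) * prod_list (map (($) x) is))"
    have seg: "t *\<^sub>R x \<in> ball 0 1" if "0 \<le> t" "t \<le> 1" for t
      using that x mult_left_le_one_le[of "norm x" t] by (simp add: mult.commute)
    have H: "(H j has_real_derivative H (Suc j) t) (at t)" if "j < Suc d" "0 \<le> t" "t \<le> 1" for j t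
    proof -
      have "(H j has_real_derivative (\<Sum>is | length is = j.
          (\<Sum>i\<in>UNIV. x $ i * F (i # is) (t *\<^sub>R x)) * prod_list (map (($) x) is))) (at t)"
        unfolding H_def using that
        by (intro DERIV_sum DERIV_cmult_right jet_deriv_ray[OF F] seg) auto
      also have "(\<Sum>is | length is = j.
          (\<Sum>i\<in>UNIV. x $ i * F (i # is) (t *\<^sub>R x)) * prod_list (map (($) x) is)) = H (Suc j) t"
        by (simp add: H_def sum_lists_Suc sum_distrib_left sum_distrib_right mult_ac)
      finally show ?thesis .
    qed
    obtain t where t: "0 < t" "t < 1"
      "H 0 1 = (\<Sum>j<Suc d. H j 0 / fact j * 1 ^ j) + H (Suc d) t / fact (Suc d) * 1 ^ Suc d"
      using Maclaurin[of 1 "Suc d" H "H 0"] H by auto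
    have "H 0 1 = F [] x"
      by (simp add: H_def)
    moreover have "(\<Sum>j<Suc d. H j 0 / fact j * 1 ^ j) = P x"
      by (simp add: H_def P_def sum_divide_distrib)
    ultimately have "F [] x - P x = H (Suc d) t / fact (Suc d)"
      using t(3) by simp
    moreover have "\<bar>H (Suc d) t\<bar> \<le> m"
    proof -
      have "\<bar>H (Suc d) t\<bar> \<le> (\<Sum>is | length is = Suc d. \<bar>F is (t *\<^sub>R x)\<bar> * \<bar>prod_list (map (($) x) is)\<bar>)"
        unfolding H_def abs_mult[symmetric] by (rule sum_abs)
      also have "\<dots> \<le> (\<Sum>is | length is = Suc d. \<bar>F is (t *\<^sub>R x)\<bar>)"
        using x by (intro sum_mono mult_left_le abs_prod_list_le_1) auto
      also have "\<dots> \<le> m"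
        using seg[of t] t by (intro m) auto
      finally show ?thesis .
    qed
    ultimately show ?thesis
      by (simp add: divide_right_mono del: fact_Suc)
  qed
  \<comment> \<open>Jets are differentiable only in the open ball, so for x on the sphere the ray
    argument fails at t = 1; continuity extends the estimate.\<close>
  have "\<bar>F [] x - P x\<bar> \<le> m / fact (Suc d)" if x: "x \<in> cball 0 1" for x
  proof (rule continuous_le_on_closure[of "ball 0 1" "\<lambda>x. \<bar>F [] x - P x\<bar>" x])
    show "continuous_on (closure (ball 0 1)) (\<lambda>x. \<bar>F [] x - P x\<bar>)"
      using jetD_cont[OF F, of "[]"] poly_fun_le_continuous[OF P]
      by (intro continuous_on_rabs continuous_on_diff) auto
  qed (use x ball in auto)
  then show ?thesis
    by (rule that[OF P])
qed

section \<open>Remez constants\<close>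

text \<open>The admissible constants as real numbers: \<open>Remez\<close> is infinite exactly when
  there are none.\<close>

definition remez_bounds :: "nat \<Rightarrow> (real ^ 'n::finite) set \<Rightarrow> real set" where
  "remez_bounds d Z = {K. \<forall>P\<in>poly_fun_le d.
     (SUP x\<in>cball 0 1. \<bar>P x\<bar>) \<le> K * (SUP z\<in>Z. \<bar>P z\<bar>)}"

text \<open>Test with the polynomial 1.\<close>

lemma remez_bounds_ge_1:
  fixes Z :: "(real ^ 'n::finite) set"
  assumes "Z \<noteq> {}" and K: "K \<in> remez_bounds d Z"
  shows "1 \<le> K"
proof -
  have "(SUP x\<in>cball (0 :: real ^ 'n) 1. \<bar>1 :: real\<bar>) \<le> K * (SUP z\<in>Z. \<bar>1 :: real\<bar>)"
    using bspec[OF K[unfolded remez_bounds_def mem_Collect_eq] poly_fun_le_const[of 1 d]] .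
  moreover have "cball (0 :: real ^ 'n) 1 \<noteq> {}"
    by simp
  ultimately show ?thesis
    using assms(1) by simp
qed

text \<open>Removes \<open>ereal\<close> from the rest of the argument. The infimum is at least 1,
  so its reciprocal is harmless.\<close>

lemma inv_Remez_cases:
  fixes Z :: "(real ^ 'n::finite) set"
  assumes "Z \<noteq> {}"
  obtains "remez_bounds d Z = {}" "inv_Remez d Z = 0"
  | "remez_bounds d Z \<noteq> {}" "1 \<le> Inf (remez_bounds d Z)"
    "inv_Remez d Z = 1 / Inf (remez_bounds d Z)"
proof -
  have eq: "Remez d Z = (INF K\<in>remez_bounds d Z. ereal K)"
    unfolding Remez_def remez_bounds_def by (simp add: image_Collect)
  show ?thesis
  proof (cases "remez_bounds d Z = {}")
    case True
    then have "Remez d Z = \<infinity>"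
      by (simp add: eq top_ereal_def)
    then have "inv_Remez d Z = 0"
      by (simp add: inv_Remez_def)
    then show ?thesis
      using True that(1) by simp
  next
    case False
    have bdd: "bdd_below (remez_bounds d Z)"
      using remez_bounds_ge_1[OF assms] by (intro bdd_belowI)
    have ge: "1 \<le> Inf (remez_bounds d Z)"
      using False remez_bounds_ge_1[OF assms] by (intro cInf_greatest)
    have "Remez d Z = ereal (Inf (remez_bounds d Z))"
      unfolding eq by (rule ereal_Inf'[OF bdd False, symmetric])
    then have "inv_Remez d Z = 1 / Inf (remez_bounds d Z)"
      using ge by (simp add: inv_Remez_def one_ereal_def)
    then show ?thesis
      using False ge that(2) by simp
  qed
qed

text \<open>Every positive K below the infimum R is inadmissible, so letting K tend to R gives
  \<open>b * R \<le> c\<close>. If no K is admissible, K may grow without bound and b must be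
  0.\<close>

lemma le_mult_inv_Remez:
  assumes "Z \<noteq> {}" and "0 \<le> b" and "0 \<le> c"
    and bound: "\<And>K. 0 < K \<Longrightarrow> K \<notin> remez_bounds d Z \<Longrightarrow> b * K \<le> c"
  shows "b \<le> c * inv_Remez d Z"
proof (cases rule: inv_Remez_cases[OF assms(1), of d, case_names 1 2])
  case 1
  \<comment> \<open>This K gives \<open>b * K = c + b\<close>, which exceeds c.\<close>
  have "b * (c / b + 1) \<le> c" if "0 < b"
    using 1(1) that \<open>0 \<le> c\<close> by (intro bound) (auto intro: add_nonneg_pos)
  then have "\<not> 0 < b"
    by (auto simp: distrib_left)
  then show ?thesis
    using 1(2) \<open>0 \<le> b\<close> by simp
next
  case 2
  define R where "R = Inf (remez_bounds d Z)"
  have "b * R \<le> c"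
  proof (rule ccontr)
    assume *: "\<not> b * R \<le> c"
    then have "0 < b"
      using \<open>0 \<le> b\<close> \<open>0 \<le> c\<close> by (cases "b = 0") auto
    then have "c / b < R"
      using * by (simp add: field_simps)
    then obtain K where K: "c / b < K" "K < R"
      using dense by blast
    have "0 \<le> c / b"
      using \<open>0 \<le> c\<close> \<open>0 < b\<close> by simp
    then have "0 < K"
      using K(1) by linarith
    moreover have "K \<notin> remez_bounds d Z"
    proof
      assume "K \<in> remez_bounds d Z"
      then have "R \<le> K"
        unfolding R_def using remez_bounds_ge_1[OF assms(1)] by (intro cInf_lower bdd_belowI)
      then show False using K(2) by simp
    qed
    ultimately have "b * K \<le> c" by (rule bound)
    then show False
      using K(1) \<open>0 < b\<close> by (simp add: field_simps)
  qed
  then have "b \<le> c / R"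
    using 2(2) by (simp add: R_def pos_le_divide_eq)
  then show ?thesis
    using 2(3) by (simp add: R_def)
qed

text \<open>The product form avoids division by \<open>M (d + 1) f\<close>, whose positivity is
  deduced from it in \<open>RG_lower_bound\<close>.\<close>

lemma M_lower_bound:
  fixes Z :: "(real ^ 'n::finite) set"
  assumes "Z \<noteq> {}" "Z \<subseteq> cball 0 1" and f: "f \<in> U d Z" and K: "K \<in> remez_bounds d Z"
  shows "fact (d + 1) / 2 \<le> K * M (d + 1) f"
proof -
  have C: "C_ball (d + 1) f" and Z0: "\<And>z. z \<in> Z \<Longrightarrow> f z = 0" and M0: "M 0 f = 1"
    using f by (auto simp: U_def)
  define e where "e = M (d + 1) f / fact (Suc d)"
  have m: "(\<Sum>is | length is = Suc d. \<bar>partials is f z\<bar>) \<le> M (d + 1) f" if "z \<in> cball 0 1" for z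
    using deriv_norm_le_M[OF C, of "d + 1" z] that by (simp add: deriv_norm_def)
  have jet: "jet (Suc d) (\<lambda>is. partials is f)"
    using jet_partials[OF C] by simp
  obtain P where P: "P \<in> poly_fun_le d"
    and "\<And>x. x \<in> cball 0 1 \<Longrightarrow> \<bar>partials [] f x - P x\<bar> \<le> M (d + 1) f / fact (Suc d)"
    using jet_taylor[OF jet m] by blast
  then have approx: "\<bar>f x - P x\<bar> \<le> e" if "x \<in> cball 0 1" for x
    using that by (simp add: partials_def e_def)
  have "0 \<le> e"
    using M_nonneg[OF C, of "d + 1"] by (simp add: e_def)
  have "(SUP z\<in>Z. \<bar>P z\<bar>) \<le> e"
    using assms(1,2) Z0 approx by (intro cSUP_least) fastforce+
  have bdd: "bdd_above ((\<lambda>x. \<bar>P x\<bar>) ` cball 0 1)"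
    using poly_fun_le_continuous[OF P]
    by (intro bounded_imp_bdd_above compact_imp_bounded compact_continuous_image
        continuous_on_rabs) auto
  have "M 0 f \<le> (SUP x\<in>cball 0 1. \<bar>P x\<bar>) + e"
  proof (rule M_le)
    fix z :: "real ^ 'n" assume z: "z \<in> cball 0 1"
    have "\<bar>P z\<bar> \<le> (SUP x\<in>cball 0 1. \<bar>P x\<bar>)"
      using bdd z by (rule cSUP_upper2) simp
    then show "deriv_norm 0 f z \<le> (SUP x\<in>cball 0 1. \<bar>P x\<bar>) + e"
      using approx[OF z] by (simp add: deriv_norm_0)
  qed
  also have "(SUP x\<in>cball 0 1. \<bar>P x\<bar>) \<le> K * (SUP z\<in>Z. \<bar>P z\<bar>)"
    using K P by (simp add: remez_bounds_def)
  also have "\<dots> \<le> K * e"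
    using \<open>(SUP z\<in>Z. \<bar>P z\<bar>) \<le> e\<close> remez_bounds_ge_1[OF assms(1) K] by (intro mult_left_mono) auto
  finally have "1 \<le> K * e + e" by (simp add: M0)
  moreover have "1 * e \<le> K * e"
    using remez_bounds_ge_1[OF assms(1) K] \<open>0 \<le> e\<close> by (rule mult_right_mono)
  ultimately have "1 / 2 \<le> K * e" by simp
  then have "1 / 2 * fact (Suc d) \<le> K * e * fact (Suc d)"
    by (rule mult_right_mono) simp
  then show ?thesis
    by (simp add: e_def del: fact_Suc)
qed

text \<open>A real infimum over the empty set carries no information, so nonemptiness of
  \<open>U d Z\<close> is tracked throughout.\<close>

lemma RG_nonneg: "U d Z \<noteq> {} \<Longrightarrow> 0 \<le> RG d Z"
  unfolding RG_def by (rule cINF_greatest) (auto simp: U_def intro!: M_nonneg)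

text \<open>Dividing G by the maximum of its absolute value on the ball gives a competitor; c only
  has to bound this maximum from below.\<close>

lemma RG_le:
  fixes Z :: "(real ^ 'n::finite) set"
  assumes G: "jet (Suc d) G" and Z: "\<And>z. z \<in> Z \<Longrightarrow> G [] z = 0"
    and x: "x \<in> cball 0 1" "c \<le> \<bar>G [] x\<bar>" "0 < c"
    and m: "\<And>z. z \<in> cball 0 1 \<Longrightarrow> (\<Sum>is | length is = Suc d. \<bar>G is z\<bar>) \<le> m"
  shows "U d Z \<noteq> {}" and "RG d Z \<le> m / c"
proof -
  have "continuous_on (cball 0 1) (\<lambda>x. \<bar>G [] x\<bar>)"
    by (intro continuous_on_rabs jetD_cont[OF G]) simp
  then obtain w where w: "w \<in> cball 0 1" "\<And>y. y \<in> cball 0 1 \<Longrightarrow> \<bar>G [] y\<bar> \<le> \<bar>G [] w\<bar>"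
    using continuous_attains_sup[of "cball (0 :: real ^ 'n) 1" "\<lambda>x. \<bar>G [] x\<bar>"] by auto
  define a where "a = \<bar>G [] w\<bar>"
  have a: "c \<le> a" "0 < a"
    using w(2)[OF x(1)] x by (auto simp: a_def)
  define f where "f = (\<lambda>x. 1 / a * G [] x)"
  have jet: "jet (Suc d) (\<lambda>is x. 1 / a * G is x)"
    by (rule jet_cmult[OF G])
  have C: "C_ball (Suc d) f"
    using C_ball_jet[OF jet] by (simp add: f_def)
  have f_Z: "\<forall>z\<in>Z. f z = 0"
    using Z by (simp add: f_def)
  have "M 0 f = 1"
  proof (rule antisym)
    show "M 0 f \<le> 1"
      using w(2) a by (intro M_le) (simp add: deriv_norm_0 f_def a_def abs_mult)
    have "deriv_norm 0 f w = 1"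
      using a by (simp add: deriv_norm_0 f_def a_def abs_mult)
    then show "1 \<le> M 0 f"
      using deriv_norm_le_M[OF C _ w(1), of 0] by simp
  qed
  then have f: "f \<in> U d Z"
    using C f_Z by (simp add: U_def)
  then show "U d Z \<noteq> {}" by blast
  have "0 \<le> (\<Sum>is | length is = Suc d. \<bar>G is x\<bar>)"
    by (intro sum_nonneg) simp
  also have "\<dots> \<le> m"
    by (rule m[OF x(1)])
  finally have "0 \<le> m" .
  have "RG d Z \<le> M (d + 1) f"
    unfolding RG_def using f
    by (intro cINF_lower bdd_belowI[of _ 0]) (auto simp: U_def intro!: M_nonneg)
  also have "\<dots> \<le> m / a"
  proof (rule M_le)
    fix z :: "real ^ 'n" assume z: "z \<in> cball 0 1"
    have "deriv_norm (d + 1) f z = (\<Sum>is | length is = Suc d. \<bar>1 / a * G is z\<bar>)"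
      unfolding deriv_norm_def f_def using partials_jet[OF jet _ z] by (intro sum.cong) auto
    also have "\<dots> = (\<Sum>is | length is = Suc d. \<bar>G is z\<bar>) / a"
      using a(2) by (simp add: abs_mult sum_divide_distrib)
    also have "\<dots> \<le> m / a"
      using a(2) m[OF z] by (simp add: divide_right_mono)
    finally show "deriv_norm (d + 1) f z \<le> m / a" .
  qed
  also have "\<dots> \<le> m / c"
    using a x(3) \<open>0 \<le> m\<close> by (intro divide_left_mono) auto
  finally show "RG d Z \<le> m / c" .
qed

section \<open>Corrected polynomials\<close>

text \<open>Applied to bumps with disjoint supports, this keeps the number of points of Z out of the
  constant.\<close>

lemma sum_at_most_one_nonzero_le:
  fixes h :: "'a \<Rightarrow> real"
  assumes "finite Z" and "0 \<le> b" and "\<And>z. z \<in> Z \<Longrightarrow> h z \<le> b"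
    and unique: "\<And>z w. z \<in> Z \<Longrightarrow> w \<in> Z \<Longrightarrow> h z \<noteq> 0 \<Longrightarrow> h w \<noteq> 0 \<Longrightarrow> z = w"
  shows "(\<Sum>z\<in>Z. h z) \<le> b"
proof (cases "\<exists>z\<in>Z. h z \<noteq> 0")
  case True
  then obtain z where z: "z \<in> Z" "h z \<noteq> 0" by blast
  then have "(\<Sum>w\<in>Z. h w) = (\<Sum>w\<in>{z}. h w)"
    using assms(1) unique by (intro sum.mono_neutral_right) auto
  then show ?thesis
    using assms(3) z by simp
qed (use \<open>0 \<le> b\<close> in simp)

text \<open>G is P corrected near Z. Its closeness to P preserves a large value of P and serves K >
  2; its agreement with P away from Z serves P = 1 at a midpoint.\<close>

definition correctable :: "real \<Rightarrow> nat \<Rightarrow> real \<Rightarrow> (real ^ 'n::finite) set \<Rightarrow> bool" where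
  "correctable C d \<rho> Z \<longleftrightarrow> (\<forall>P\<in>poly_fun_le d. \<forall>s\<ge>0. (\<forall>z\<in>Z. \<bar>P z\<bar> \<le> s) \<longrightarrow>
     (\<exists>G. jet (Suc d) G \<and> (\<forall>z\<in>Z. G [] z = 0) \<and>
        (\<forall>x. (\<Sum>is | length is = Suc d. \<bar>G is x\<bar>) \<le> C / \<rho> ^ Suc d * s) \<and>
        (\<forall>x. \<bar>G [] x - P x\<bar> \<le> s) \<and>
        (\<forall>x. (\<forall>z\<in>Z. \<rho> / 2 \<le> dist x z) \<longrightarrow> G [] x = P x)))"

lemma separated_imp_correctable:
  "\<exists>C>0. \<forall>Z \<rho>. finite Z \<and> 0 < \<rho> \<and> (\<forall>z\<in>Z. \<forall>w\<in>Z. z \<noteq> w \<longrightarrow> \<rho> \<le> dist z w) \<longrightarrow>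
    correctable C d \<rho> (Z :: (real ^ 'n::finite) set)"
proof -
  define n where "n = real CARD('n)"
  have n: "1 \<le> n" by (simp add: n_def Suc_le_eq)
  obtain D B where D: "tower (Suc d) D" "D 0 0 = 1" "\<And>t. 0 \<le> D 0 t \<and> D 0 t \<le> 1"
    "\<And>j t. 1 \<le> \<bar>t\<bar> \<Longrightarrow> j \<le> Suc d \<Longrightarrow> D j t = 0"
    and B: "1 \<le> B" "\<And>j t. j \<le> Suc d \<Longrightarrow> \<bar>D j t\<bar> \<le> B"
    using bump_tower[of "Suc d"] by metis
  \<comment> \<open>There are \<open>n ^ Suc d\<close> derivatives of order d + 1, each at most
    \<open>B ^ n / r ^ Suc d\<close> times s, and 1 / r is \<open>2 * n / \<rho>\<close>. Nothing
    here depends on Z.\<close>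
  define C where "C = n ^ Suc d * (B ^ CARD('n) * (2 * n) ^ Suc d)"
  have "correctable C d \<rho> Z"
    if fin: "finite Z" and \<rho>: "0 < \<rho>" and sep: "\<forall>z\<in>Z. \<forall>w\<in>Z. z \<noteq> w \<longrightarrow> \<rho> \<le> dist z w"
    for Z :: "(real ^ 'n) set" and \<rho>
    unfolding correctable_def
  proof (intro ballI allI impI)
    fix P :: "real ^ 'n \<Rightarrow> real" and s :: real
    assume P: "P \<in> poly_fun_le d" and "0 \<le> s" and "\<forall>z\<in>Z. \<bar>P z\<bar> \<le> s"
    then have s: "0 \<le> s" "\<And>z. z \<in> Z \<Longrightarrow> \<bar>P z\<bar> \<le> s" by auto
    \<comment> \<open>A bump lives on a cube of half side r. Its points have l1 distance, hence
      Euclidean distance, less than \<open>n * r = \<rho> / 2\<close> from the centre, so different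
      bumps cannot overlap.\<close>
    define r where "r = \<rho> / (2 * n)"
    have r: "0 < r"
      using \<rho> n by (simp add: r_def)
    define \<Phi> where "\<Phi> = (\<lambda>z is x. \<Prod>i\<in>(UNIV :: 'n set).
      D (count_list is i) ((x $ i - z $ i) / r) / r ^ count_list is i)"
    have jet_\<Phi>: "jet (Suc d) (\<Phi> z)" for z
      unfolding \<Phi>_def using r D(1)
      by (intro jet_prod[where D = "\<lambda>i j t. D j ((t - z $ i) / r) / r ^ j"] tower_affine) auto
    have near: "dist x z < \<rho> / 2" if "\<Phi> z is x \<noteq> 0" "length is \<le> Suc d" for z "is" x
    proof -
      have "\<bar>(x - z) $ i\<bar> < r" for i
      proof (rule ccontr)
        assume "\<not> \<bar>(x - z) $ i\<bar> < r"
        then have "1 \<le> \<bar>(x $ i - z $ i) / r\<bar>"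
          using r by (simp add: field_simps)
        then have "D (count_list is i) ((x $ i - z $ i) / r) = 0"
          using count_le_length[of "is" i] that(2) by (intro D(4)) auto
        then have "\<Phi> z is x = 0"
          unfolding \<Phi>_def by (intro prod_zero) auto
        then show False using that(1) by simp
      qed
      then have "(\<Sum>i\<in>UNIV. \<bar>(x - z) $ i\<bar>) < (\<Sum>i\<in>(UNIV :: 'n set). r)"
        by (intro sum_strict_mono) auto
      also have "\<dots> = \<rho> / 2"
        using n by (simp add: r_def n_def)
      finally show ?thesis
        using norm_le_l1_cart[of "x - z"] by (simp add: dist_norm)
    qed
    have unique: "z = w"
      if "z \<in> Z" "w \<in> Z" "\<Phi> z is x \<noteq> 0" "\<Phi> w is x \<noteq> 0" "length is \<le> Suc d" for z w "is" x
    proof (rule ccontr)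
      assume "z \<noteq> w"
      then have "\<rho> \<le> dist z w"
        using that sep by simp
      then show False
        using near[OF that(3,5)] near[OF that(4,5)] dist_triangle[of z w x]
        by (simp add: dist_commute)
    qed
    have bound: "\<bar>\<Phi> z is x\<bar> \<le> B ^ CARD('n) / r ^ length is" if "length is \<le> Suc d" for z "is" x
    proof -
      have "\<bar>\<Phi> z is x\<bar> = (\<Prod>i\<in>(UNIV :: 'n set). \<bar>D (count_list is i) ((x $ i - z $ i) / r)\<bar>)
          / (\<Prod>i\<in>(UNIV :: 'n set). r ^ count_list is i)"
        using r by (simp add: \<Phi>_def abs_prod prod_dividef abs_mult)
      also have "(\<Prod>i\<in>(UNIV :: 'n set). r ^ count_list is i) = r ^ length is"
        by (simp add: power_sum[symmetric] sum_count_list)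
      also have "(\<Prod>i\<in>(UNIV :: 'n set). \<bar>D (count_list is i) ((x $ i - z $ i) / r)\<bar>)
          \<le> (\<Prod>i\<in>(UNIV :: 'n set). B)"
        using count_le_length[of "is"] that by (intro prod_mono conjI B(2)) (auto intro: le_trans)
      finally show ?thesis
        using r by (simp add: divide_right_mono)
    qed
    have \<Phi>_0: "0 \<le> \<Phi> z [] x \<and> \<Phi> z [] x \<le> 1" for z x
      using D(3) by (auto simp: \<Phi>_def intro!: prod_nonneg prod_le_1)
    \<comment> \<open>Used with \<open>b = B ^ n / r ^ Suc d\<close> for the derivatives of top
      order and with b = 1 for the values.\<close>
    have correction: "\<bar>\<Sum>z\<in>Z. P z * \<Phi> z is x\<bar> \<le> s * b"
      if "length is \<le> Suc d" "\<And>z. \<bar>\<Phi> z is x\<bar> \<le> b" for "is" x b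
    proof -
      have b: "0 \<le> b"
        using that(2) abs_ge_zero order_trans by blast
      have "\<bar>\<Sum>z\<in>Z. P z * \<Phi> z is x\<bar> \<le> (\<Sum>z\<in>Z. \<bar>P z * \<Phi> z is x\<bar>)"
        by (rule sum_abs)
      also have "\<dots> \<le> s * b"
      proof (rule sum_at_most_one_nonzero_le[OF fin])
        show "\<bar>P z * \<Phi> z is x\<bar> \<le> s * b" if "z \<in> Z" for z
          unfolding abs_mult using s(2)[OF that] \<open>\<bar>\<Phi> z is x\<bar> \<le> b\<close> s(1)
          by (intro mult_mono) auto
        show "z = w" if "z \<in> Z" "w \<in> Z" "\<bar>P z * \<Phi> z is x\<bar> \<noteq> 0" "\<bar>P w * \<Phi> w is x\<bar> \<noteq> 0" for z w
          using that \<open>length is \<le> Suc d\<close> by (intro unique[of z w "is" x]) auto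
      qed (use s b in simp)
      finally show ?thesis .
    qed
    obtain F where F: "jet (Suc d) F" "F [] = P" "\<And>is x. d < length is \<Longrightarrow> F is x = 0"
      using poly_fun_le_jet[OF P] by blast
    define G where "G = (\<lambda>is x. F is x - (\<Sum>z\<in>Z. P z * \<Phi> z is x))"
    have "jet (Suc d) G"
      unfolding G_def by (intro jet_diff F jet_sum jet_cmult jet_\<Phi>)
    moreover have "G [] z = 0" if z: "z \<in> Z" for z
    proof -
      have "\<Phi> w [] z = 0" if "w \<in> Z" "w \<noteq> z" for w
        using near[of w "[]" z] sep z that \<rho> by force
      then have "(\<Sum>w\<in>Z. P w * \<Phi> w [] z) = (\<Sum>w\<in>{z}. P w * \<Phi> w [] z)"
        using fin z by (intro sum.mono_neutral_right) auto
      moreover have "\<Phi> z [] z = 1"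
        by (simp add: \<Phi>_def D(2))
      ultimately show ?thesis
        by (simp add: G_def F(2))
    qed
    moreover have "(\<Sum>is | length is = Suc d. \<bar>G is x\<bar>) \<le> C / \<rho> ^ Suc d * s" for x
    proof -
      \<comment> \<open>The polynomial part vanishes at order d + 1, so only the correction
        contributes.\<close>
      have "\<bar>G is x\<bar> \<le> s * (B ^ CARD('n) / r ^ Suc d)" if "length is = Suc d" for "is"
        using correction[of "is" x "B ^ CARD('n) / r ^ Suc d"] bound[of "is" _ x] that F(3)[of "is" x]
        by (simp add: G_def)
      then have "(\<Sum>is | length is = Suc d. \<bar>G is x\<bar>)
          \<le> (\<Sum>is | length (is :: 'n list) = Suc d. s * (B ^ CARD('n) / r ^ Suc d))"
        by (intro sum_mono) simp
      also have "\<dots> = real (card {is :: 'n list. length is = Suc d}) * (s * (B ^ CARD('n) / r ^ Suc d))"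
        by (rule sum_constant)
      also have "real (card {is :: 'n list. length is = Suc d}) = n ^ Suc d"
        using card_lists_length_eq[of "UNIV :: 'n set" "Suc d"] by (simp add: n_def)
      also have "n ^ Suc d * (s * (B ^ CARD('n) / r ^ Suc d)) = C / \<rho> ^ Suc d * s"
        by (simp only: C_def r_def power_divide divide_divide_eq_right times_divide_eq_left
            times_divide_eq_right mult_ac)
      finally show ?thesis .
    qed
    moreover have "\<bar>G [] x - P x\<bar> \<le> s" for x
      using correction[of "[]" x 1] \<Phi>_0[of _ x] by (simp add: G_def F(2) abs_le_iff)
    moreover have "G [] x = P x" if "\<forall>z\<in>Z. \<rho> / 2 \<le> dist x z" for x
    proof -
      have "\<Phi> z [] x = 0" if "z \<in> Z" for z
        using near[of z "[]" x] \<open>\<forall>z\<in>Z. \<rho> / 2 \<le> dist x z\<close> that by force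
      then show ?thesis
        by (simp add: G_def F(2))
    qed
    ultimately show "\<exists>G. jet (Suc d) G \<and> (\<forall>z\<in>Z. G [] z = 0) \<and>
        (\<forall>x. (\<Sum>is | length is = Suc d. \<bar>G is x\<bar>) \<le> C / \<rho> ^ Suc d * s) \<and>
        (\<forall>x. \<bar>G [] x - P x\<bar> \<le> s) \<and>
        (\<forall>x. (\<forall>z\<in>Z. \<rho> / 2 \<le> dist x z) \<longrightarrow> G [] x = P x)"
      by (intro exI[of _ G] conjI allI ballI impI)
  qed
  moreover have "0 < C"
    using n B(1) by (simp add: C_def)
  ultimately show ?thesis by blast
qed

section \<open>Minimal distance and the two bounds for the rigidity constant\<close>

lemma min_dist_props:
  assumes "finite Z" and "2 \<le> card Z"
  shows "0 < min_dist Z" and "\<And>z w. z \<in> Z \<Longrightarrow> w \<in> Z \<Longrightarrow> z \<noteq> w \<Longrightarrow> min_dist Z \<le> dist z w"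
    and "\<exists>z\<in>Z. \<exists>w\<in>Z. dist z w = min_dist Z"
proof -
  define S where "S = {dist x y | x y. x \<in> Z \<and> y \<in> Z \<and> x \<noteq> y}"
  have "S \<subseteq> (\<lambda>(x, y). dist x y) ` (Z \<times> Z)"
    by (auto simp: S_def)
  then have fin: "finite S"
    using assms(1) finite_subset by blast
  obtain x y where "x \<in> Z" "y \<in> Z" "x \<noteq> y"
    using assms(2) by (metis card_2_iff' ex_card subset_iff)
  then have "S \<noteq> {}"
    by (auto simp: S_def)
  then have "min_dist Z \<in> S"
    using Min_in[OF fin] by (simp add: min_dist_def S_def)
  then obtain z w where "min_dist Z = dist z w" "z \<in> Z" "w \<in> Z" "z \<noteq> w"
    unfolding S_def by blast
  then show "0 < min_dist Z" "\<exists>z\<in>Z. \<exists>w\<in>Z. dist z w = min_dist Z"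
    by auto
  show "min_dist Z \<le> dist z w" if "z \<in> Z" "w \<in> Z" "z \<noteq> w" for z w
    unfolding min_dist_def using fin that by (intro Min_le) (auto simp: S_def)
qed

lemma RG_bounds:
  fixes Z :: "(real ^ 'n::finite) set"
  assumes fin: "finite Z" and card: "2 \<le> card Z" and Z: "Z \<subseteq> cball 0 1" and "0 < C"
    and corr: "correctable C d (min_dist Z) Z"
  shows "U d Z \<noteq> {}" and "RG d Z \<le> 2 * C / min_dist Z ^ (d + 1) * inv_Remez d Z"
proof -
  have "Z \<noteq> {}" using card by auto
  define c where "c = C / min_dist Z ^ Suc d"
  have c: "0 \<le> c"
    using \<open>0 < C\<close> min_dist_props(1)[OF fin card] by (simp add: c_def)
  obtain z w where zw: "z \<in> Z" "w \<in> Z" "dist z w = min_dist Z"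
    using min_dist_props(3)[OF fin card] by blast
  \<comment> \<open>By the triangle inequality this midpoint of a closest pair keeps distance at
    least \<rho> / 2 from all of Z, and it lies in the ball by convexity.\<close>
  define m where "m = midpoint z w"
  have m: "m \<in> cball 0 1"
    using closed_segment_subset[OF _ _ convex_cball, of z 0 1 w] zw(1,2) Z
      midpoint_in_closed_segment[of z w] unfolding m_def by blast
  have far: "min_dist Z / 2 \<le> dist m u" if u: "u \<in> Z" for u
  proof (cases "u = z")
    case True
    then show ?thesis by (simp add: m_def dist_midpoint zw(3))
  next
    case False
    have "min_dist Z \<le> dist u z"
      using min_dist_props(2)[OF fin card u zw(1) False] .
    moreover have "dist u z \<le> dist m u + dist m z"
      using dist_triangle[of u z m] by (simp add: dist_commute)
    moreover have "dist m z = min_dist Z / 2"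
      by (simp add: m_def dist_midpoint zw(3))
    ultimately show ?thesis by simp
  qed
  \<comment> \<open>Correction of P = 1 with s = 1. It shows that \<open>U d Z\<close> is nonempty
    and that \<open>RG d Z \<le> c\<close>.\<close>
  obtain G where G: "jet (Suc d) G" "\<And>z. z \<in> Z \<Longrightarrow> G [] z = 0" "G [] m = 1"
    "\<And>x. (\<Sum>is | length is = Suc d. \<bar>G is x\<bar>) \<le> c"
    using corr[unfolded correctable_def, THEN bspec, OF poly_fun_le_const[of 1], THEN spec, of 1] far
    by (auto simp: c_def)
  show U: "U d Z \<noteq> {}"
    using RG_le(1)[OF G(1,2) m _ _ G(4), where c = 1] G(3) by simp
  have RG_c: "RG d Z \<le> c"
    using RG_le(2)[OF G(1,2) m _ _ G(4), where c = 1] G(3) by simp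
  have "RG d Z * K \<le> 2 * c" if K: "0 < K" "K \<notin> remez_bounds d Z" for K
  proof (cases "K \<le> 2")
    case True
    then have "RG d Z * K \<le> c * 2"
      using RG_c RG_nonneg[OF U] c K(1) by (intro mult_mono) auto
    then show ?thesis by simp
  next
    case False
    obtain P where P: "P \<in> poly_fun_le d"
      "K * (SUP z\<in>Z. \<bar>P z\<bar>) < (SUP x\<in>cball 0 1. \<bar>P x\<bar>)"
      using K(2) by (auto simp: remez_bounds_def not_le)
    define s where "s = (SUP z\<in>Z. \<bar>P z\<bar>)"
    have s: "\<bar>P z\<bar> \<le> s" if "z \<in> Z" for z
      unfolding s_def using that fin by (intro cSUP_upper) auto
    have "0 \<le> s"
      using s[OF zw(1)] by linarith
    have "\<exists>x\<in>cball 0 1. K * s < \<bar>P x\<bar>"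
    proof (rule ccontr)
      assume "\<not> ?thesis"
      then have "(SUP x\<in>cball 0 1. \<bar>P x\<bar>) \<le> K * s"
        by (intro cSUP_least) (auto simp: not_less)
      then show False
        using P(2) by (simp add: s_def)
    qed
    then obtain x where x: "x \<in> cball 0 1" "K * s < \<bar>P x\<bar>" by blast
    obtain G where G: "jet (Suc d) G" "\<And>z. z \<in> Z \<Longrightarrow> G [] z = 0"
      "\<And>x. (\<Sum>is | length is = Suc d. \<bar>G is x\<bar>) \<le> c * s" "\<And>x. \<bar>G [] x - P x\<bar> \<le> s"
      using corr[unfolded correctable_def, THEN bspec, OF P(1), THEN spec, of s] \<open>0 \<le> s\<close> s
      by (auto simp: c_def)
    have "2 * s \<le> K * s"
      using False \<open>0 \<le> s\<close> by (intro mult_right_mono) auto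
    \<comment> \<open>A lower bound for \<open>\<bar>G [] x\<bar>\<close>. As K > 2, s is at most
      half of \<open>K * s\<close>, so a exceeds \<open>K * s / 2\<close>; strictness keeps it
      positive even when s = 0.\<close>
    define a where "a = \<bar>P x\<bar> - s"
    have a: "0 < a" "s * K \<le> 2 * a"
      using x(2) \<open>0 \<le> s\<close> \<open>2 * s \<le> K * s\<close> by (simp_all add: a_def mult.commute)
    have "a \<le> \<bar>G [] x\<bar>"
      using G(4)[of x] by (simp add: a_def)
    then have "RG d Z \<le> c * s / a"
      using a(1) by (intro RG_le(2)[OF G(1,2) x(1) _ _ G(3)])
    then have "RG d Z * K \<le> c * s / a * K"
      using K(1) by (intro mult_right_mono) auto
    also have "\<dots> = c * (s * K / a)"
      by simp
    also have "\<dots> \<le> c * 2"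
      using a c by (intro mult_left_mono) (simp_all add: pos_divide_le_eq)
    finally show ?thesis by simp
  qed
  then have "RG d Z \<le> 2 * c * inv_Remez d Z"
    using RG_nonneg[OF U] c by (intro le_mult_inv_Remez[OF \<open>Z \<noteq> {}\<close>]) auto
  then show "RG d Z \<le> 2 * C / min_dist Z ^ (d + 1) * inv_Remez d Z"
    by (simp add: c_def)
qed

text \<open>Passes from single K and f to both infima. The nonemptiness of \<open>U d Z\<close> is
  supplied by the construction in \<open>RG_bounds\<close>.\<close>

lemma RG_lower_bound:
  fixes Z :: "(real ^ 'n::finite) set"
  assumes "Z \<noteq> {}" "Z \<subseteq> cball 0 1" and U: "U d Z \<noteq> {}"
  shows "fact (d + 1) / 2 * inv_Remez d Z \<le> RG d Z"
proof (cases rule: inv_Remez_cases[OF assms(1), of d, case_names 1 2])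
  case 1
  then show ?thesis using RG_nonneg[OF U] by simp
next
  case 2
  define R where "R = Inf (remez_bounds d Z)"
  show ?thesis
    unfolding RG_def
  proof (rule cINF_greatest[OF U])
    fix f assume f: "f \<in> U d Z"
    obtain K where K: "K \<in> remez_bounds d Z"
      using 2(1) by blast
    have "0 < K * M (d + 1) f"
      using M_lower_bound[OF assms(1,2) f K] by (rule less_le_trans[rotated]) simp
    then have M: "0 < M (d + 1) f"
      using remez_bounds_ge_1[OF assms(1) K] by (simp add: zero_less_mult_iff)
    \<comment> \<open>For fixed f the quotient is below every admissible K, hence below their
      infimum.\<close>
    have "fact (d + 1) / 2 / M (d + 1) f \<le> R"
      unfolding R_def using 2(1) M_lower_bound[OF assms(1,2) f] M
      by (intro cInf_greatest) (simp_all add: pos_divide_le_eq mult_ac del: fact_Suc)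
    then show "fact (d + 1) / 2 * inv_Remez d Z \<le> M (d + 1) f"
      using M 2(2,3) by (simp add: R_def pos_divide_le_eq mult_ac del: fact_Suc)
  qed
qed

theorem theorem4p2:
  fixes d :: nat
  assumes "d \<ge> 1"
  shows "\<exists>C>0. \<forall>Z :: (real ^ 'n::finite) set.
    finite Z \<and> card Z \<ge> 2 \<and> Z \<subseteq> cball 0 1 \<longrightarrow>
      fact (d + 1) / 2 * inv_Remez d Z \<le> RG d Z \<and>
      RG d Z \<le> C / min_dist Z ^ (d + 1) * inv_Remez d Z"
proof -
  \<comment> \<open>C is fixed before Z and \<rho>; the final constant \<open>2 * C\<close> takes
    its factor 2 from \<open>RG_bounds\<close>.\<close>
  obtain C where C: "0 < C" "\<And>Z \<rho>. finite Z \<Longrightarrow> 0 < \<rho> \<Longrightarrow>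
      \<forall>z\<in>Z. \<forall>w\<in>Z. z \<noteq> w \<longrightarrow> \<rho> \<le> dist z w \<Longrightarrow> correctable C d \<rho> (Z :: (real ^ 'n) set)"
    using separated_imp_correctable[where 'n = 'n and d = d] by auto
  show ?thesis
  proof (intro exI[of _ "2 * C"] conjI allI impI; (elim conjE)?)
    show "0 < 2 * C"
      using C(1) by simp
  next
    fix Z :: "(real ^ 'n) set"
    assume Z: "finite Z" "2 \<le> card Z" "Z \<subseteq> cball 0 1"
    have "correctable C d (min_dist Z) Z"
      using Z min_dist_props(1,2)[OF Z(1,2)] by (intro C(2)) auto
    note bounds = RG_bounds[OF Z C(1) this]
    show "RG d Z \<le> 2 * C / min_dist Z ^ (d + 1) * inv_Remez d Z"
      by (rule bounds(2))
    show "fact (d + 1) / 2 * inv_Remez d Z \<le> RG d Z"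
      using Z by (intro RG_lower_bound bounds(1)) auto
  qed
qed

end
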